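(* Let $\{T_\theta\}_{\theta\in U}$ satisfy the standing assumptions (i)–(iv) of the context. Suppose $\mathrm{tag}(\bar\theta)=(0,\mathrm{fin})$ and take the center family $\theta_\varepsilon^{c}\equiv\bar\theta$. Let $\{\theta_\varepsilon^{p}\}_{\varepsilon\downarrow0}$ be a petal family, and suppose that for some $\gamma\in(0,1)$ and all sufficiently small $\varepsilon$: $\theta_\varepsilon^{p}\ne\bar\theta$, $\mathrm{tag}(\theta_\varepsilon^{p})=(0,\mathrm{fin})$, and there are witnesses $z_\varepsilon\in V_\varepsilon^{p}$ with $$\sup_\varepsilon\|z_\varepsilon\|_{\mathcal H}<\infty\quad\text{and}\quad\mathrm{dist}_{\mathcal H}(z_\varepsilon,\mathrm{Fix}(T_{\bar\theta}))=\Theta(\|\theta_\varepsilon^{p}-\bar\theta\|_{\mathcal D}^{\gamma}).$$ Then there is an afterimage slow region family $\{\mathcal S_\varepsilon\}_{\varepsilon\downarrow0}$ for $\{\theta_\varepsilon^{c}\}$ with respect to $\{\theta_\varepsilon^{p}\}$ whose vanishing modulus satisfies $\rho_\varepsilon=O(\|\theta_\varepsilon^{p}-\bar\theta\|_{\mathcal D}^{1-\gamma})$. Moreover, if there is a constant $l_U$ such that $\sup_{z\in\mathcal H}\|\delta_\theta z-\delta_{\theta'}z\|_{\mathcal H}\le l_U\|\theta-\theta'\|_{\mathcal D}$ for all $\theta,\theta'\in U$, then the same conclusion holds without the requirement $\sup_\varepsilon\|z_\varepsilon\|_{\mathcal H}<\infty$.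
   Context: **Setting.** $\mathcal X,\mathcal Y,\mathcal H$ are finite-dimensional real Hilbert spaces, $\mathcal K\subseteq\mathcal X$ is a closed convex cone with dual cone $\mathcal K^*$. A parameter is $\theta=(\mathcal A,b,c)\in\mathcal D:=\mathcal L(\mathcal X,\mathcal Y)\times\mathcal Y\times\mathcal X$ (with $\mathcal L(\mathcal X,\mathcal Y)$ the linear maps), normed by $\|\theta\|_{\mathcal D}^2:=\|\mathcal A\|_{\mathrm{HS}}^2+\|b\|_{\mathcal Y}^2+\|c\|_{\mathcal X}^2$. Put $\mathrm{KKT}(\theta):=\{(x,y,s):\mathcal Ax=b,\ \mathcal A^*y+s=c,\ \langle x,s\rangle_{\mathcal X}=0,\ x\in\mathcal K,\ s\in\mathcal K^*\}$ and $\mathcal D_{\mathrm{KKT}}:=\{\theta\in\mathcal D:\mathrm{KKT}(\theta)\ne\emptyset\}$. Let $\bar\theta\in\mathrm{cl}(\mathcal D_{\mathrm{KKT}})$ and let $U\subset\mathcal D$ be compact with $\bar\theta\in U$. To each $\theta\in U$ is associated a map $T_\theta:\mathcal H\to\mathcal H$, with residual map $\delta_\theta:=T_\theta-\mathrm{Id}$ and fixed point set $\mathrm{Fix}(T_\theta)$. **Standing assumptions.** (i) For every $\theta\in U$: $\mathrm{Fix}(T_\theta)\ne\emptyset$ iff $\theta\in\mathcal D_{\mathrm{KKT}}$. (ii) For every $\theta\in U$, $T_\theta$ is $\alpha_\theta$-averaged for some $\alpha_\theta\in(0,1)$ (i.e. $T_\theta=(1-\alpha_\theta)\mathrm{Id}+\alpha_\theta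 N_\theta$ with $N_\theta$ nonexpansive) with respect to the inner product $\langle z,w\rangle_\theta:=\langle z,G_\theta w\rangle_{\mathcal H}$, $G_\theta$ self-adjoint positive definite on $\mathcal H$. (iii) There are $0<m_U\le M_U<\infty$ with $m_U\mathrm{Id}\preceq G_\theta\preceq M_U\mathrm{Id}$ for all $\theta\in U$. (iv) There is $L_U(r)=a+a'r$ with $a,a'\ge0$ such that $\|T_\theta z-T_{\theta'}z\|_{\mathcal H}\le L_U(\|z\|_{\mathcal H})\,\|\theta-\theta'\|_{\mathcal D}$ for all $\theta,\theta'\in U$, $z\in\mathcal H$. **Drift and tag.** For $\theta\in U$, the forward drift $v_\theta$ is the projection of $0$ onto the closed convex set $\mathrm{cl}(\mathrm{ran}(\delta_\theta))$ in the norm $\|\cdot\|_\theta$. $\mathrm{tag}(\theta)\in\{0,+\}\times\{\mathrm{fin},\mathrm{inf}\}$: the first entry is $0$ iff $v_\theta=0$; the second is $\mathrm{fin}$ iff $v_\theta\in\mathrm{ran}(\delta_\theta)$. (So $\mathrm{tag}(\theta)=(0,\mathrm{fin})$ iff $\mathrm{Fix}(T_\theta)\neq\emptyset$.) **Families.** All conditions on families indexed by $\varepsilon\downarrow0$ are required only for all sufficiently small $\varepsilon>0$. A center family is $\{\theta_\varepsilon^{c}\}_{\varepsilon\downarrow0}\subset U\cap\mathcal D_{\mathrm{KKT}}$ with $\theta_\varepsilon^{c}\to\bar\theta$; a petal family is $\{\theta_\varepsilon^{p}\}_{\varepsilon\downarrow0}\subset U$ with $\theta_\varepsilon^{p}\to\bar\theta$.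 Write $\delta_\varepsilon^{c}:=\delta_{\theta_\varepsilon^{c}}$, $\delta_\varepsilon^{p}:=\delta_{\theta_\varepsilon^{p}}$, $v_\varepsilon^{p}:=v_{\theta_\varepsilon^{p}}$, $V_\varepsilon^{c}:=\mathrm{Fix}(T_{\theta_\varepsilon^{c}})$, and $V_\varepsilon^{p}:=\{z\in\mathcal H:\delta_\varepsilon^{p}(z)=v_\varepsilon^{p}\}$. $\mathrm{dist}_{\mathcal H}$ is the distance in $\|\cdot\|_{\mathcal H}$. $f_\varepsilon=\Theta(g_\varepsilon)$ means $c_0g_\varepsilon\le f_\varepsilon\le C_0g_\varepsilon$ for some constants $C_0\ge c_0>0$ and all small $\varepsilon$. **Slow region (SR) family.** $\{\mathcal S_\varepsilon\}_{\varepsilon\downarrow0}$, $\mathcal S_\varepsilon\subset\mathcal H$, is an SR family of $\{\theta_\varepsilon^{c}\}$ iff (1) $\mathcal S_\varepsilon\ne\emptyset$ and $\mathcal S_\varepsilon\cap V_\varepsilon^{c}=\emptyset$; (2) its vanishing modulus $\rho_\varepsilon:=\sup_{z\in\mathcal S_\varepsilon}\|\delta_\varepsilon^{c}(z)\|_{\mathcal H}/\mathrm{dist}_{\mathcal H}(z,V_\varepsilon^{c})$ is finite and $\rho_\varepsilon\to0$. **Afterimage slow region (ASR) family.** An SR family $\{\mathcal S_\varepsilon\}$ of $\{\theta_\varepsilon^{c}\}$ is an ASR family with respect to a petal family $\{\theta_\varepsilon^{p}\}$ iff there are $\mu_\varepsilon\ge0$ with $\mu_\varepsilon\to0$ and $\|\delta_\varepsilon^{p}(z)-v_\varepsilon^{p}\|_{\mathcal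 H}\le\mu_\varepsilon$ for all $z\in\mathcal S_\varepsilon$. *)

theory Defs
  imports "HOL-Analysis.Analysis" "HOL-Library.Landau_Symbols"
begin

section \<open>The parameter space\<close>

type_synonym ('x, 'y) param = "('x \<Rightarrow>\<^sub>L 'y) \<times> 'y \<times> 'x"

definition hs_norm :: "('x::euclidean_space \<Rightarrow>\<^sub>L 'y::euclidean_space) \<Rightarrow> real" where
  "hs_norm A = sqrt (\<Sum>i\<in>Basis. (norm (blinfun_apply A i))\<^sup>2)"

definition norm_D :: "('x::euclidean_space, 'y::euclidean_space) param \<Rightarrow> real" where
  "norm_D = (\<lambda>(A, b, c). sqrt ((hs_norm A)\<^sup>2 + (norm b)\<^sup>2 + (norm c)\<^sup>2))"

text \<open>
  The norm that the library puts on the parameter type is built from the operator norm, not from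
  the Hilbert--Schmidt norm. The two norms are equivalent (lemma \<open>norm_D_equiv\<close>), so compactness,
  closures and limits in the library topology are those of \<^const>\<open>norm_D\<close>. All quantitative
  conditions below use \<^const>\<open>norm_D\<close>.
\<close>

lemma norm_le_hs_norm: "norm A \<le> hs_norm A"
proof (rule norm_blinfun_bound)
  show "0 \<le> hs_norm A"
    by (simp add: hs_norm_def sum_nonneg)
  fix x :: 'a
  have "blinfun_apply A x = blinfun_apply A (\<Sum>i\<in>Basis. (x \<bullet> i) *\<^sub>R i)"
    by (simp add: euclidean_representation)
  also have "\<dots> = (\<Sum>i\<in>Basis. (x \<bullet> i) *\<^sub>R blinfun_apply A i)"
    by (simp add: blinfun.sum_right blinfun.scaleR_right)
  finally have "norm (blinfun_apply A x) \<le> (\<Sum>i\<in>Basis. norm ((x \<bullet> i) *\<^sub>R blinfun_apply A i))"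
    by (simp only: norm_sum)
  also have "\<dots> = (\<Sum>i\<in>Basis. \<bar>x \<bullet> i\<bar> * \<bar>norm (blinfun_apply A i)\<bar>)"
    by simp
  also have "\<dots> \<le> L2_set (\<lambda>i. x \<bullet> i) Basis * L2_set (\<lambda>i. norm (blinfun_apply A i)) Basis"
    by (rule L2_set_mult_ineq)
  also have "\<dots> = hs_norm A * norm x"
    by (simp add: hs_norm_def L2_set_def norm_eq_sqrt_inner euclidean_inner[of x x]
        power2_eq_square)
  finally show "norm (blinfun_apply A x) \<le> hs_norm A * norm x" .
qed

lemma hs_norm_le_norm:
  fixes A :: "'x::euclidean_space \<Rightarrow>\<^sub>L 'y::euclidean_space"
  shows "(hs_norm A)\<^sup>2 \<le> DIM('x) * (norm A)\<^sup>2"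
proof -
  have "(\<Sum>i\<in>Basis. (norm (blinfun_apply A i))\<^sup>2) \<le> (\<Sum>i\<in>(Basis :: 'x set). (norm A)\<^sup>2)"
  proof (rule sum_mono)
    fix i :: 'x assume "i \<in> Basis"
    then show "(norm (blinfun_apply A i))\<^sup>2 \<le> (norm A)\<^sup>2"
      using norm_blinfun[of A i] by (intro power_mono) auto
  qed
  then show ?thesis
    by (simp add: hs_norm_def sum_nonneg)
qed

lemma norm_D_equiv:
  fixes \<theta> :: "('x::euclidean_space, 'y::euclidean_space) param"
  shows "norm \<theta> \<le> norm_D \<theta>" "norm_D \<theta> \<le> sqrt DIM('x) * norm \<theta>"
proof -
  obtain A b c where \<theta>: "\<theta> = (A, b, c)" by (cases \<theta>)
  have "(norm A)\<^sup>2 \<le> (hs_norm A)\<^sup>2"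
    by (intro power_mono norm_le_hs_norm) auto
  then show "norm \<theta> \<le> norm_D \<theta>"
    by (simp add: \<theta> norm_D_def norm_Pair)
  have "1 * ((norm b)\<^sup>2 + (norm c)\<^sup>2) \<le> real DIM('x) * ((norm b)\<^sup>2 + (norm c)\<^sup>2)"
    by (rule mult_right_mono) (use DIM_positive[where 'a='x] in \<open>auto simp: Suc_le_eq\<close>)
  then have "(hs_norm A)\<^sup>2 + (norm b)\<^sup>2 + (norm c)\<^sup>2
      \<le> DIM('x) * ((norm A)\<^sup>2 + ((norm b)\<^sup>2 + (norm c)\<^sup>2))"
    using hs_norm_le_norm[of A] by (simp add: distrib_left)
  then show "norm_D \<theta> \<le> sqrt DIM('x) * norm \<theta>"
    by (simp add: \<theta> norm_D_def norm_Pair flip: real_sqrt_mult)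
qed

section \<open>KKT solutions\<close>

definition dual_cone :: "'x::real_inner set \<Rightarrow> 'x set" where
  "dual_cone K = {s. \<forall>x\<in>K. 0 \<le> x \<bullet> s}"

definition KKT ::
  "'x::euclidean_space set \<Rightarrow> ('x, 'y::euclidean_space) param \<Rightarrow> ('x \<times> 'y \<times> 'x) set" where
  "KKT K = (\<lambda>(A, b, c). {(x, y, s). blinfun_apply A x = b \<and> adjoint (blinfun_apply A) y + s = c \<and>
     x \<bullet> s = 0 \<and> x \<in> K \<and> s \<in> dual_cone K})"

definition D_KKT :: "'x::euclidean_space set \<Rightarrow> ('x, 'y::euclidean_space) param set" where
  "D_KKT K = {\<theta>. KKT K \<theta> \<noteq> {}}"

section \<open>Averaged operators, drift and tag\<close>

definition residual :: "('h \<Rightarrow> 'h) \<Rightarrow> 'h \<Rightarrow> 'h::real_inner" where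
  "residual T z = T z - z"

definition Fix :: "('h \<Rightarrow> 'h) \<Rightarrow> 'h set" where
  "Fix T = {z. T z = z}"

definition self_adjoint_pos_def :: "('h::real_inner \<Rightarrow> 'h) \<Rightarrow> bool" where
  "self_adjoint_pos_def G \<longleftrightarrow>
     linear G \<and> (\<forall>z w. G z \<bullet> w = z \<bullet> G w) \<and> (\<forall>z. z \<noteq> 0 \<longrightarrow> 0 < z \<bullet> G z)"

definition wnorm :: "('h::real_inner \<Rightarrow> 'h) \<Rightarrow> 'h \<Rightarrow> real" where
  "wnorm G z = sqrt (z \<bullet> G z)"

definition averaged :: "('h::real_inner \<Rightarrow> 'h) \<Rightarrow> real \<Rightarrow> ('h \<Rightarrow> 'h) \<Rightarrow> bool" where
  "averaged G \<alpha> T \<longleftrightarrow>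
     (\<exists>N. (\<forall>z w. wnorm G (N z - N w) \<le> wnorm G (z - w)) \<and>
          (\<forall>z. T z = (1 - \<alpha>) *\<^sub>R z + \<alpha> *\<^sub>R N z))"

definition standing_assumptions ::
  "'x::euclidean_space set \<Rightarrow> ('x, 'y::euclidean_space) param set \<Rightarrow>
   (('x, 'y) param \<Rightarrow> 'h \<Rightarrow> 'h) \<Rightarrow> (('x, 'y) param \<Rightarrow> 'h \<Rightarrow> 'h::euclidean_space) \<Rightarrow> bool" where
  "standing_assumptions K U T G \<longleftrightarrow>
     (\<forall>\<theta>\<in>U. Fix (T \<theta>) \<noteq> {} \<longleftrightarrow> \<theta> \<in> D_KKT K) \<and>
     (\<forall>\<theta>\<in>U. self_adjoint_pos_def (G \<theta>) \<and> (\<exists>\<alpha>. 0 < \<alpha> \<and> \<alpha> < 1 \<and> averaged (G \<theta>) \<alpha> (T \<theta>))) \<and>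
     (\<exists>m M. 0 < m \<and> m \<le> M \<and>
        (\<forall>\<theta>\<in>U. \<forall>z. m * (z \<bullet> z) \<le> z \<bullet> G \<theta> z \<and> z \<bullet> G \<theta> z \<le> M * (z \<bullet> z))) \<and>
     (\<exists>a a'. 0 \<le> a \<and> 0 \<le> a' \<and>
        (\<forall>\<theta>\<in>U. \<forall>\<theta>'\<in>U. \<forall>z. norm (T \<theta> z - T \<theta>' z) \<le> (a + a' * norm z) * norm_D (\<theta> - \<theta>')))"

text \<open>
  The projection of the origin onto the closure of the range of the residual map, in the weighted
  norm. The minimiser is unique when \<open>T\<close> is averaged with respect to \<open>G\<close>, since that closure is
  then convex.
\<close>

definition drift :: "('h \<Rightarrow> 'h) \<Rightarrow> ('h \<Rightarrow> 'h) \<Rightarrow> 'h::euclidean_space" where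
  "drift G T = arg_min_on (wnorm G) (closure (range (residual T)))"

datatype drift_tag = Zero_Drift | Positive_Drift

datatype attainment_tag = Fin_Tag | Inf_Tag

definition tag :: "('h \<Rightarrow> 'h) \<Rightarrow> ('h \<Rightarrow> 'h::euclidean_space) \<Rightarrow> drift_tag \<times> attainment_tag" where
  "tag G T =
     (if drift G T = 0 then Zero_Drift else Positive_Drift,
      if drift G T \<in> range (residual T) then Fin_Tag else Inf_Tag)"

definition drift_set :: "('h \<Rightarrow> 'h) \<Rightarrow> ('h \<Rightarrow> 'h) \<Rightarrow> 'h::euclidean_space set" where
  "drift_set G T = {z. residual T z = drift G T}"

section \<open>Families and slow regions\<close>

text \<open>
  A family indexed by \<open>\<epsilon> \<down> 0\<close> is a function on the reals; only its values at all sufficiently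
  small positive \<open>\<epsilon>\<close> matter, which is what the filter \<open>at_right 0\<close> expresses.
\<close>

definition center_family ::
  "'x::euclidean_space set \<Rightarrow> ('x, 'y::euclidean_space) param set \<Rightarrow> ('x, 'y) param \<Rightarrow>
   (real \<Rightarrow> ('x, 'y) param) \<Rightarrow> bool" where
  "center_family K U \<theta>bar \<theta>c \<longleftrightarrow>
     (\<forall>\<^sub>F \<epsilon> in at_right 0. \<theta>c \<epsilon> \<in> U \<inter> D_KKT K) \<and> (\<theta>c \<longlongrightarrow> \<theta>bar) (at_right 0)"

definition petal_family ::
  "('x::euclidean_space, 'y::euclidean_space) param set \<Rightarrow> ('x, 'y) param \<Rightarrow>
   (real \<Rightarrow> ('x, 'y) param) \<Rightarrow> bool" where
  "petal_family U \<theta>bar \<theta>p \<longleftrightarrow>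
     (\<forall>\<^sub>F \<epsilon> in at_right 0. \<theta>p \<epsilon> \<in> U) \<and> (\<theta>p \<longlongrightarrow> \<theta>bar) (at_right 0)"

text \<open>
  The difference quotients whose supremum is the vanishing modulus. As \<^const>\<open>Sup\<close> on the reals
  is meaningful only for bounded sets, finiteness of the modulus is stated as \<^const>\<open>bdd_above\<close>.
\<close>

definition slow_quotients :: "('h \<Rightarrow> 'h) \<Rightarrow> 'h::euclidean_space set \<Rightarrow> real set" where
  "slow_quotients T S = (\<lambda>z. norm (residual T z) / infdist z (Fix T)) ` S"

definition vanishing_modulus :: "('h \<Rightarrow> 'h) \<Rightarrow> 'h::euclidean_space set \<Rightarrow> real" where
  "vanishing_modulus T S = Sup (slow_quotients T S)"

definition SR_family ::
  "'x::euclidean_space set \<Rightarrow> ('x, 'y::euclidean_space) param set \<Rightarrow>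
   (('x, 'y) param \<Rightarrow> 'h \<Rightarrow> 'h::euclidean_space) \<Rightarrow> ('x, 'y) param \<Rightarrow>
   (real \<Rightarrow> ('x, 'y) param) \<Rightarrow> (real \<Rightarrow> 'h set) \<Rightarrow> bool" where
  "SR_family K U T \<theta>bar \<theta>c S \<longleftrightarrow>
     center_family K U \<theta>bar \<theta>c \<and>
     (\<forall>\<^sub>F \<epsilon> in at_right 0. S \<epsilon> \<noteq> {} \<and> S \<epsilon> \<inter> Fix (T (\<theta>c \<epsilon>)) = {}) \<and>
     (\<forall>\<^sub>F \<epsilon> in at_right 0. bdd_above (slow_quotients (T (\<theta>c \<epsilon>)) (S \<epsilon>))) \<and>
     ((\<lambda>\<epsilon>. vanishing_modulus (T (\<theta>c \<epsilon>)) (S \<epsilon>)) \<longlongrightarrow> 0) (at_right 0)"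

definition ASR_family ::
  "'x::euclidean_space set \<Rightarrow> ('x, 'y::euclidean_space) param set \<Rightarrow>
   (('x, 'y) param \<Rightarrow> 'h \<Rightarrow> 'h) \<Rightarrow> (('x, 'y) param \<Rightarrow> 'h \<Rightarrow> 'h::euclidean_space) \<Rightarrow>
   ('x, 'y) param \<Rightarrow> (real \<Rightarrow> ('x, 'y) param) \<Rightarrow> (real \<Rightarrow> ('x, 'y) param) \<Rightarrow>
   (real \<Rightarrow> 'h set) \<Rightarrow> bool" where
  "ASR_family K U T G \<theta>bar \<theta>c \<theta>p S \<longleftrightarrow>
     SR_family K U T \<theta>bar \<theta>c S \<and> petal_family U \<theta>bar \<theta>p \<and>
     (\<exists>\<mu>. (\<forall>\<^sub>F \<epsilon> in at_right 0. 0 \<le> \<mu> \<epsilon>) \<and> (\<mu> \<longlongrightarrow> 0) (at_right 0) \<and>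
        (\<forall>\<^sub>F \<epsilon> in at_right 0. \<forall>z\<in>S \<epsilon>.
           norm (residual (T (\<theta>p \<epsilon>)) z - drift (G (\<theta>p \<epsilon>)) (T (\<theta>p \<epsilon>))) \<le> \<mu> \<epsilon>))"

end

theory Submission
  imports Defs
begin

text \<open>
  The slow region consists of a single point, the witness \<open>z \<epsilon>\<close>. Zero drift of the petal makes
  \<open>z \<epsilon>\<close> an exact fixed point of the petal operator, so the afterimage bound holds with
  \<open>\<mu> = 0\<close>. Put \<open>d = norm_D (\<theta>p \<epsilon> - \<theta>bar)\<close>. The residual of the center operator at \<open>z \<epsilon>\<close> is
  the difference of the petal and the center operator there, and Lipschitz continuity in the
  parameter bounds it by a multiple of \<open>d\<close>; yet \<open>z \<epsilon>\<close> lies at distance at least a positive multiple of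
  \<open>d powr \<gamma>\<close> from the fixed points of the center. The ratio is of order \<open>d powr (1 - \<gamma>)\<close>, which
  tends to \<open>0\<close> (lemmas \<open>slow_quotient_at_perturbed_fixed_point\<close> and \<open>ASR_family_of_witnesses\<close>).

  The two alternatives of the theorem are two ways to make the Lipschitz constant uniform along
  the witnesses: the bound \<open>a + a' * norm (z \<epsilon>)\<close> of the standing assumptions stays bounded when
  the witnesses do, and a Lipschitz constant that is uniform in space serves for all witnesses.
\<close>

lemma slow_quotients_singleton:
  "slow_quotients T {w} = {norm (residual T w) / infdist w (Fix T)}"
  by (simp add: slow_quotients_def)

lemma vanishing_modulus_singleton:
  "vanishing_modulus T {w} = norm (residual T w) / infdist w (Fix T)"
  by (simp add: vanishing_modulus_def slow_quotients_singleton)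

lemma norm_D_pos:
  fixes \<theta> :: "('x::euclidean_space, 'y::euclidean_space) param"
  assumes "\<theta> \<noteq> 0"
  shows "0 < norm_D \<theta>"
  using norm_D_equiv(1)[of \<theta>] assms by (metis zero_less_norm_iff less_le_trans)

lemma tendsto_norm_D_diff:
  fixes f :: "'a \<Rightarrow> ('x::euclidean_space, 'y::euclidean_space) param"
  assumes "(f \<longlongrightarrow> l) F"
  shows "((\<lambda>t. norm_D (f t - l)) \<longlongrightarrow> 0) F"
proof (rule tendsto_sandwich)
  show "\<forall>\<^sub>F t in F. 0 \<le> norm_D (f t - l)"
    by (intro always_eventually allI order_trans[OF norm_ge_zero norm_D_equiv(1)])
  show "\<forall>\<^sub>F t in F. norm_D (f t - l) \<le> sqrt DIM('x) * norm (f t - l)"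
    by (intro always_eventually allI norm_D_equiv(2))
  show "((\<lambda>t. sqrt DIM('x) * norm (f t - l)) \<longlongrightarrow> 0) F"
    using assms by (intro tendsto_mult_right_zero tendsto_norm_zero) (simp add: LIM_zero_iff)
qed simp

lemma tag_Zero_Drift_imp_drift_eq_0:
  "tag G T = (Zero_Drift, t) \<Longrightarrow> drift G T = 0"
  by (simp add: tag_def split: if_splits)

lemma Fix_nonempty_of_tag:
  assumes "tag G T = (Zero_Drift, Fin_Tag)"
  shows "Fix T \<noteq> {}"
proof -
  have "drift G T = 0" "drift G T \<in> range (residual T)"
    using assms by (simp_all add: tag_def split: if_splits)
  then obtain w where "residual T w = 0"
    by auto
  then have "w \<in> Fix T"
    by (simp add: residual_def Fix_def)
  then show ?thesis
    by blast
qed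

text \<open>
  A fixed point of \<open>T'\<close> nearly solves the fixed point equation of \<open>T\<close> when the two operators are
  close at it, so a Hoelder displacement of order \<open>\<gamma>\<close> leaves the power \<open>1 - \<gamma>\<close> in the ratio
  of residual and distance.
\<close>

lemma slow_quotient_at_perturbed_fixed_point:
  fixes T T' :: "'h \<Rightarrow> 'h::euclidean_space"
  assumes fixed: "w \<in> Fix T'"
    and close: "norm (T' w - T w) \<le> C * d"
    and far: "c * d powr \<gamma> \<le> infdist w (Fix T)"
    and pos: "0 < c" "0 < d"
  shows "norm (residual T w) / infdist w (Fix T) \<le> C / c * d powr (1 - \<gamma>)"
proof -
  have "norm (residual T w) = norm (T' w - T w)"
    using fixed by (simp add: residual_def Fix_def norm_minus_commute)
  then have "norm (residual T w) / infdist w (Fix T) \<le> (C * d) / (c * d powr \<gamma>)"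
    using close far pos by (intro frac_le) (auto intro: order_trans[OF norm_ge_zero])
  also have "\<dots> = C / c * d powr (1 - \<gamma>)"
    using pos by (simp add: powr_diff)
  finally show ?thesis .
qed

text \<open>
  The closeness hypothesis speaks of the witnesses alone, with one constant for all of them, so that
  both forms of parameter continuity in the theorem are instances of it.
\<close>

lemma ASR_family_of_witnesses:
  fixes K :: "'x::euclidean_space set"
    and U :: "('x, 'y::euclidean_space) param set"
    and T G :: "('x, 'y) param \<Rightarrow> 'h \<Rightarrow> 'h::euclidean_space"
    and z :: "real \<Rightarrow> 'h"
  assumes center: "\<theta>bar \<in> U" "\<theta>bar \<in> D_KKT K"
    and petal: "petal_family U \<theta>bar \<theta>p"
    and \<gamma>: "\<gamma> < 1"
    and ne: "\<forall>\<^sub>F \<epsilon> in at_right 0. \<theta>p \<epsilon> \<noteq> \<theta>bar"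
    and drift0: "\<forall>\<^sub>F \<epsilon> in at_right 0. drift (G (\<theta>p \<epsilon>)) (T (\<theta>p \<epsilon>)) = 0"
    and fixed: "\<forall>\<^sub>F \<epsilon> in at_right 0. z \<epsilon> \<in> Fix (T (\<theta>p \<epsilon>))"
    and far: "(\<lambda>\<epsilon>. infdist (z \<epsilon>) (Fix (T \<theta>bar)))
                \<in> \<Omega>[at_right 0](\<lambda>\<epsilon>. norm_D (\<theta>p \<epsilon> - \<theta>bar) powr \<gamma>)"
    and close: "\<forall>\<^sub>F \<epsilon> in at_right 0.
                  norm (T (\<theta>p \<epsilon>) (z \<epsilon>) - T \<theta>bar (z \<epsilon>)) \<le> C * norm_D (\<theta>p \<epsilon> - \<theta>bar)"
  shows "ASR_family K U T G \<theta>bar (\<lambda>_. \<theta>bar) \<theta>p (\<lambda>\<epsilon>. {z \<epsilon>})"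
    and "(\<lambda>\<epsilon>. vanishing_modulus (T \<theta>bar) {z \<epsilon>})
           \<in> O[at_right 0](\<lambda>\<epsilon>. norm_D (\<theta>p \<epsilon> - \<theta>bar) powr (1 - \<gamma>))"
proof -
  let ?d = "\<lambda>\<epsilon>. norm_D (\<theta>p \<epsilon> - \<theta>bar)"
  have dpos: "\<forall>\<^sub>F \<epsilon> in at_right 0. 0 < ?d \<epsilon>"
    using ne by eventually_elim (simp add: norm_D_pos)
  obtain c where "0 < c"
    and c: "\<forall>\<^sub>F \<epsilon> in at_right 0. c * ?d \<epsilon> powr \<gamma> \<le> infdist (z \<epsilon>) (Fix (T \<theta>bar))"
    using landau_omega.bigE[OF far] by (auto simp: infdist_nonneg)
  have bound: "\<forall>\<^sub>F \<epsilon> in at_right 0.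
      vanishing_modulus (T \<theta>bar) {z \<epsilon>} \<le> C / c * ?d \<epsilon> powr (1 - \<gamma>)"
    using dpos c fixed close
  proof eventually_elim
    case (elim \<epsilon>)
    then show ?case
      unfolding vanishing_modulus_singleton
      using \<open>0 < c\<close> by (intro slow_quotient_at_perturbed_fixed_point) auto
  qed
  have nonneg: "0 \<le> vanishing_modulus (T \<theta>bar) {z \<epsilon>}" for \<epsilon>
    by (simp add: vanishing_modulus_singleton infdist_nonneg)
  show "(\<lambda>\<epsilon>. vanishing_modulus (T \<theta>bar) {z \<epsilon>})
          \<in> O[at_right 0](\<lambda>\<epsilon>. ?d \<epsilon> powr (1 - \<gamma>))"
    using bound nonneg by (intro bigoI[where c = "C / c"]) simp
  have "((\<lambda>\<epsilon>. ?d \<epsilon> powr (1 - \<gamma>)) \<longlongrightarrow> 0) (at_right 0)"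
  proof (rule tendsto_zero_powrI)
    show "(?d \<longlongrightarrow> 0) (at_right 0)"
      using petal by (intro tendsto_norm_D_diff) (simp add: petal_family_def)
    show "\<forall>\<^sub>F \<epsilon> in at_right 0. 0 \<le> ?d \<epsilon>"
      using dpos by eventually_elim simp
  qed (use \<gamma> in auto)
  then have "((\<lambda>\<epsilon>. C / c * ?d \<epsilon> powr (1 - \<gamma>)) \<longlongrightarrow> 0) (at_right 0)"
    by (rule tendsto_mult_right_zero)
  then have modulus: "((\<lambda>\<epsilon>. vanishing_modulus (T \<theta>bar) {z \<epsilon>}) \<longlongrightarrow> 0) (at_right 0)"
    using bound nonneg by (intro tendsto_sandwich[OF _ bound tendsto_const]) simp_all
  have disjoint: "\<forall>\<^sub>F \<epsilon> in at_right 0. {z \<epsilon>} \<noteq> {} \<and> {z \<epsilon>} \<inter> Fix (T \<theta>bar) = {}"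
    using dpos c
  proof eventually_elim
    case (elim \<epsilon>)
    then have "0 < infdist (z \<epsilon>) (Fix (T \<theta>bar))"
      using \<open>0 < c\<close> by (intro less_le_trans[OF _ elim(2)]) simp
    then show ?case
      by auto
  qed
  have afterimage: "\<forall>\<^sub>F \<epsilon> in at_right 0. \<forall>w\<in>{z \<epsilon>}.
      norm (residual (T (\<theta>p \<epsilon>)) w - drift (G (\<theta>p \<epsilon>)) (T (\<theta>p \<epsilon>))) \<le> 0"
    using drift0 fixed by eventually_elim (simp add: residual_def Fix_def)
  have "SR_family K U T \<theta>bar (\<lambda>_. \<theta>bar) (\<lambda>\<epsilon>. {z \<epsilon>})"
    using center disjoint modulus
    by (simp add: SR_family_def center_family_def slow_quotients_singleton)
  then show "ASR_family K U T G \<theta>bar (\<lambda>_. \<theta>bar) \<theta>p (\<lambda>\<epsilon>. {z \<epsilon>})"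
    unfolding ASR_family_def using petal afterimage
    by (intro conjI exI[where x = "\<lambda>_. 0"]) auto
qed

theorem theorem2p10:
  fixes K :: "'x::euclidean_space set"
    and U :: "('x, 'y::euclidean_space) param set"
    and T G :: "('x, 'y) param \<Rightarrow> 'h \<Rightarrow> 'h::euclidean_space"
    and \<theta>bar :: "('x, 'y) param"
    and \<theta>p :: "real \<Rightarrow> ('x, 'y) param"
    and z :: "real \<Rightarrow> 'h"
    and \<gamma> :: real
  assumes "closed K" and "convex_cone K"
    and "\<theta>bar \<in> closure (D_KKT K)"
    and "compact U" and "\<theta>bar \<in> U"
    and "standing_assumptions K U T G"
    and "tag (G \<theta>bar) (T \<theta>bar) = (Zero_Drift, Fin_Tag)"
    and "petal_family U \<theta>bar \<theta>p"
    and "0 < \<gamma>" and "\<gamma> < 1"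
    and "\<forall>\<^sub>F \<epsilon> in at_right 0. \<theta>p \<epsilon> \<noteq> \<theta>bar"
    and "\<forall>\<^sub>F \<epsilon> in at_right 0. tag (G (\<theta>p \<epsilon>)) (T (\<theta>p \<epsilon>)) = (Zero_Drift, Fin_Tag)"
    and "\<forall>\<^sub>F \<epsilon> in at_right 0. z \<epsilon> \<in> drift_set (G (\<theta>p \<epsilon>)) (T (\<theta>p \<epsilon>))"
    and "(\<lambda>\<epsilon>. infdist (z \<epsilon>) (Fix (T \<theta>bar)))
           \<in> \<Theta>[at_right 0](\<lambda>\<epsilon>. norm_D (\<theta>p \<epsilon> - \<theta>bar) powr \<gamma>)"
  shows "((\<exists>B. \<forall>\<^sub>F \<epsilon> in at_right 0. norm (z \<epsilon>) \<le> B) \<longrightarrow>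
            (\<exists>S. ASR_family K U T G \<theta>bar (\<lambda>_. \<theta>bar) \<theta>p S \<and>
               (\<lambda>\<epsilon>. vanishing_modulus (T \<theta>bar) (S \<epsilon>))
                 \<in> O[at_right 0](\<lambda>\<epsilon>. norm_D (\<theta>p \<epsilon> - \<theta>bar) powr (1 - \<gamma>)))) \<and>
         ((\<exists>l. \<forall>\<theta>\<in>U. \<forall>\<theta>'\<in>U. \<forall>w.
              norm (residual (T \<theta>) w - residual (T \<theta>') w) \<le> l * norm_D (\<theta> - \<theta>')) \<longrightarrow>
            (\<exists>S. ASR_family K U T G \<theta>bar (\<lambda>_. \<theta>bar) \<theta>p S \<and>
               (\<lambda>\<epsilon>. vanishing_modulus (T \<theta>bar) (S \<epsilon>))
                 \<in> O[at_right 0](\<lambda>\<epsilon>. norm_D (\<theta>p \<epsilon> - \<theta>bar) powr (1 - \<gamma>))))"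
proof -
  note standing = assms(6)[unfolded standing_assumptions_def]
  have bar_in_D_KKT: "\<theta>bar \<in> D_KKT K"
    using standing \<open>\<theta>bar \<in> U\<close> Fix_nonempty_of_tag[OF assms(7)] by blast
  have drift0: "\<forall>\<^sub>F \<epsilon> in at_right 0. drift (G (\<theta>p \<epsilon>)) (T (\<theta>p \<epsilon>)) = 0"
    using assms(12) by eventually_elim (rule tag_Zero_Drift_imp_drift_eq_0)
  have fixed: "\<forall>\<^sub>F \<epsilon> in at_right 0. z \<epsilon> \<in> Fix (T (\<theta>p \<epsilon>))"
    using drift0 assms(13)
    by eventually_elim (simp add: drift_set_def residual_def Fix_def)
  have petal_in_U: "\<forall>\<^sub>F \<epsilon> in at_right 0. \<theta>p \<epsilon> \<in> U"
    using assms(8) by (simp add: petal_family_def)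
  have family: "\<exists>S. ASR_family K U T G \<theta>bar (\<lambda>_. \<theta>bar) \<theta>p S \<and>
      (\<lambda>\<epsilon>. vanishing_modulus (T \<theta>bar) (S \<epsilon>))
        \<in> O[at_right 0](\<lambda>\<epsilon>. norm_D (\<theta>p \<epsilon> - \<theta>bar) powr (1 - \<gamma>))"
    if "\<forall>\<^sub>F \<epsilon> in at_right 0.
          norm (T (\<theta>p \<epsilon>) (z \<epsilon>) - T \<theta>bar (z \<epsilon>)) \<le> C * norm_D (\<theta>p \<epsilon> - \<theta>bar)" for C
    using ASR_family_of_witnesses[OF \<open>\<theta>bar \<in> U\<close> bar_in_D_KKT assms(8) \<open>\<gamma> < 1\<close> assms(11)
        drift0 fixed bigthetaD2[OF assms(14)] that]
    by blast
  obtain a a' where "0 \<le> a'"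
    and lip: "\<And>\<theta> \<theta>' w. \<theta> \<in> U \<Longrightarrow> \<theta>' \<in> U \<Longrightarrow>
      norm (T \<theta> w - T \<theta>' w) \<le> (a + a' * norm w) * norm_D (\<theta> - \<theta>')"
    using standing by blast
  show ?thesis
  proof (intro conjI impI)
    assume "\<exists>B. \<forall>\<^sub>F \<epsilon> in at_right 0. norm (z \<epsilon>) \<le> B"
    then obtain B where "\<forall>\<^sub>F \<epsilon> in at_right 0. norm (z \<epsilon>) \<le> B" ..
    then have "\<forall>\<^sub>F \<epsilon> in at_right 0.
        norm (T (\<theta>p \<epsilon>) (z \<epsilon>) - T \<theta>bar (z \<epsilon>)) \<le> (a + a' * B) * norm_D (\<theta>p \<epsilon> - \<theta>bar)"
      using petal_in_U
    proof eventually_elim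
      case (elim \<epsilon>)
      have "norm (T (\<theta>p \<epsilon>) (z \<epsilon>) - T \<theta>bar (z \<epsilon>))
          \<le> (a + a' * norm (z \<epsilon>)) * norm_D (\<theta>p \<epsilon> - \<theta>bar)"
        using elim \<open>\<theta>bar \<in> U\<close> by (intro lip)
      also have "\<dots> \<le> (a + a' * B) * norm_D (\<theta>p \<epsilon> - \<theta>bar)"
        using elim \<open>0 \<le> a'\<close>
        by (intro mult_right_mono add_left_mono mult_left_mono
            order_trans[OF norm_ge_zero norm_D_equiv(1)])
      finally show ?case .
    qed
    then show "\<exists>S. ASR_family K U T G \<theta>bar (\<lambda>_. \<theta>bar) \<theta>p S \<and>
        (\<lambda>\<epsilon>. vanishing_modulus (T \<theta>bar) (S \<epsilon>))
          \<in> O[at_right 0](\<lambda>\<epsilon>. norm_D (\<theta>p \<epsilon> - \<theta>bar) powr (1 - \<gamma>))"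
      by (rule family)
  next
    assume "\<exists>l. \<forall>\<theta>\<in>U. \<forall>\<theta>'\<in>U. \<forall>w.
        norm (residual (T \<theta>) w - residual (T \<theta>') w) \<le> l * norm_D (\<theta> - \<theta>')"
    then obtain l where l: "\<And>\<theta> \<theta>' w. \<theta> \<in> U \<Longrightarrow> \<theta>' \<in> U \<Longrightarrow>
        norm (T \<theta> w - T \<theta>' w) \<le> l * norm_D (\<theta> - \<theta>')"
      by (auto simp: residual_def)
    show "\<exists>S. ASR_family K U T G \<theta>bar (\<lambda>_. \<theta>bar) \<theta>p S \<and>
        (\<lambda>\<epsilon>. vanishing_modulus (T \<theta>bar) (S \<epsilon>))
          \<in> O[at_right 0](\<lambda>\<epsilon>. norm_D (\<theta>p \<epsilon> - \<theta>bar) powr (1 - \<gamma>))"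
      using petal_in_U \<open>\<theta>bar \<in> U\<close> by (intro family) (auto elim!: eventually_mono intro: l)
  qed
qed

end
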